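(* For every integer $n\geq 2$, the free semigroup $\mathcal{F}_n$ on $n$ generators $a_1,\ldots,a_n$ is a unique factorization semigroup.
   Context: The free semigroup $\mathcal{F}_n$ is taken with unit $e$ (the empty word). A discrete semigroup $S$ with unit $e$ is a unique factorization semigroup if there exists a subset $\{X_1,X_2,X_3,\ldots\}$ of $S$ (called a basis) such that (i) every non-trivial element of $S$ (i.e. every element other than $e$) can be uniquely written as $X_{i_1}^{\alpha_1}\cdots X_{i_k}^{\alpha_k}$ with $\alpha_1,\ldots,\alpha_k$ positive integers and $i_1<\cdots<i_k$; and (ii) if $e=X_1^{\beta_1}\cdots X_k^{\beta_k}$ for some non-negative integers $\beta_1,\ldots,\beta_k$, then all $\beta_i$ are zero. *)

theory Defs
  imports "HOL-Algebra.Group"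
begin

text \<open>The free semigroup with unit on a set \<open>A\<close> of generators: words over \<open>A\<close>
  under concatenation, the unit \<open>e\<close> being the empty word and a generator \<open>a\<close> being
  identified with the word \<open>[a]\<close>.\<close>

definition free_semigroup :: "'a set \<Rightarrow> 'a list monoid" where
  "free_semigroup A = \<lparr>carrier = lists A, mult = (@), one = []\<rparr>"

text \<open>For \<open>ps = [(i\<^sub>1, \<alpha>\<^sub>1), \<dots>, (i\<^sub>k, \<alpha>\<^sub>k)]\<close> this is the product
  \<open>X i\<^sub>1 [^] \<alpha>\<^sub>1 \<otimes> \<dots> \<otimes> X i\<^sub>k [^] \<alpha>\<^sub>k\<close>, in this order.\<close>

definition power_product ::
    "('a, 'b) monoid_scheme \<Rightarrow> (nat \<Rightarrow> 'a) \<Rightarrow> (nat \<times> nat) list \<Rightarrow> 'a" where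
  "power_product S X ps = foldr (\<lambda>(i, \<alpha>) t. (X i [^]\<^bsub>S\<^esub> \<alpha>) \<otimes>\<^bsub>S\<^esub> t) ps \<one>\<^bsub>S\<^esub>"

text \<open>A basis is an infinite sequence, indexed from 0 rather than from 1. Its terms are
  automatically distinct, see \<open>inj_factorization_basis\<close> below.\<close>

definition factorization_basis :: "('a, 'b) monoid_scheme \<Rightarrow> (nat \<Rightarrow> 'a) \<Rightarrow> bool" where
  "factorization_basis S X \<longleftrightarrow>
     range X \<subseteq> carrier S \<and>
     (\<forall>x \<in> carrier S - {\<one>\<^bsub>S\<^esub>}.
        \<exists>!ps. ps \<noteq> [] \<and> sorted_wrt (<) (map fst ps) \<and> (\<forall>(i, \<alpha>) \<in> set ps. 0 < \<alpha>) \<and>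
             x = power_product S X ps) \<and>
     (\<forall>k \<beta>. \<one>\<^bsub>S\<^esub> = power_product S X (map (\<lambda>i. (i, \<beta> i)) [0..<k]) \<longrightarrow> (\<forall>i<k. \<beta> i = 0))"

definition unique_factorization_semigroup :: "('a, 'b) monoid_scheme \<Rightarrow> bool" where
  "unique_factorization_semigroup S \<longleftrightarrow> monoid S \<and> (\<exists>X. factorization_basis S X)"

lemma (in monoid) inj_factorization_basis:
  assumes "factorization_basis G X"
  shows "inj X"
proof (rule injI)
  fix i j assume eq: "X i = X j"
  note basis = assms[unfolded factorization_basis_def]
  have car: "X l \<in> carrier G" for l
    using conjunct1[OF basis] by blast
  have single: "power_product G X [(l, 1)] = X l" for l
    using car[of l] by (simp add: power_product_def)
  have "X i \<noteq> \<one>"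
  proof
    assume e: "X i = \<one>"
    define \<beta> :: "nat \<Rightarrow> nat" where "\<beta> l = (if l = i then 1 else 0)" for l
    have pow: "X l [^] \<beta> l = \<one>" for l
      using e by (simp add: \<beta>_def)
    have "power_product G X (map (\<lambda>l. (l, \<beta> l)) ls) = \<one>" for ls
      unfolding power_product_def by (induction ls) (simp_all add: pow)
    then have "\<one> = power_product G X (map (\<lambda>l. (l, \<beta> l)) [0..<Suc i])"
      by (rule sym)
    then have "\<forall>l<Suc i. \<beta> l = 0"
      by (rule conjunct2[OF conjunct2[OF basis], rule_format, THEN allI[OF impI]])
    then have "\<beta> i = 0" by blast
    then show False by (simp add: \<beta>_def)
  qed
  then have "X i \<in> carrier G - {\<one>}" using car by simp
  note unique = bspec[OF conjunct1[OF conjunct2[OF basis]] this]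
  have "X i = power_product G X [(i, 1)]" "X i = power_product G X [(j, 1)]"
    unfolding single eq by (rule refl)+
  then have "[(i, 1::nat)] = [(j, 1)]"
    by (intro Uniq_D[OF ex1_iff_ex_Uniq[THEN iffD1, THEN conjunct2, OF unique]] conjI) simp_all
  then show "i = j" by simp
qed

end

theory Submission
  imports Defs
begin

text \<open>
  Words over \<open>A\<close> are factored by iterated elimination. If \<open>C\<close> is a code, that is, a set of
  words that freely generates a submonoid \<open>C\<^sup>*\<close>, and \<open>x \<in> C\<close>, then collecting each run of \<open>x\<close>
  with the codeword in front of it shows that every element of \<open>C\<^sup>*\<close> is uniquely \<open>x\<^sup>j w\<close>,
  where \<open>w\<close> is a product of words \<open>c x\<^sup>i\<close> with \<open>c \<in> C - {x}\<close>; and these words again form a code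
  (\<open>ex_power_append_star\<close>, \<open>power_append_star_unique\<close>, \<open>code_eliminate\<close>). Starting with the
  letters and eliminating an element \<open>X\<^sub>k\<close> of the \<open>k\<close>-th code \<open>C\<^sub>k\<close> at every step, one writes
  a given word \<open>w\<close> as a product of powers of \<open>X\<^sub>0, \<dots>, X\<^sub>k\<close>, in this order, and a remainder in
  \<open>C\<^sub>k\<^sub>+\<^sub>1\<^sup>*\<close>; the exponents and the remainder are unique.

  The remainder has to disappear after finitely many steps, and this depends on the choice of
  \<open>X\<^sub>k\<close>. It is taken of minimal length in \<open>C\<^sub>k\<close>: then all new words are longer than \<open>X\<^sub>k\<close>, so
  the finitely many words of the minimal length are removed one by one, and the minimal length
  of the codewords tends to infinity (\<open>stage_eventually_longer\<close>). Hence the remainder is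
  empty as soon as this length exceeds that of \<open>w\<close>. That there are at least two letters guarantees
  that the codes never become empty, so that the sequence \<open>X\<close> is infinite.
\<close>

section \<open>Codes and elimination of a codeword\<close>

definition star :: "'a list set \<Rightarrow> 'a list set" where
  "star C = concat ` lists C"

definition code :: "'a list set \<Rightarrow> bool" where
  "code C \<longleftrightarrow> inj_on concat (lists C)"

definition eliminate :: "'a list \<Rightarrow> 'a list set \<Rightarrow> 'a list set" where
  "eliminate x C = {c @ concat (replicate i x) | c i. c \<in> C - {x}}"

lemma Nil_in_star: "[] \<in> star C"
  unfolding star_def by (rule image_eqI[of _ _ "[]"]) simp_all

lemma in_star: "c \<in> C \<Longrightarrow> c \<in> star C"
  unfolding star_def by (rule image_eqI[of _ _ "[c]"]) simp_all

lemma append_in_star: "u \<in> star C \<Longrightarrow> v \<in> star C \<Longrightarrow> u @ v \<in> star C"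
  unfolding star_def by (force simp flip: concat_append intro!: imageI)

lemma power_in_star: "u \<in> star C \<Longrightarrow> concat (replicate i u) \<in> star C"
  by (induction i) (simp_all add: Nil_in_star append_in_star)

lemma star_subset_star:
  assumes "D \<subseteq> star C" shows "star D \<subseteq> star C"
proof
  fix w assume "w \<in> star D"
  then obtain us where us: "us \<in> lists D" and w: "w = concat us" unfolding star_def by blast
  from us have "concat us \<in> star C"
    using assms by (induction us) (auto simp: Nil_in_star intro: append_in_star)
  then show "w \<in> star C" by (simp add: w)
qed

lemma codeD:
  "code C \<Longrightarrow> concat us = concat vs \<Longrightarrow> us \<in> lists C \<Longrightarrow> vs \<in> lists C \<Longrightarrow> us = vs"
  unfolding code_def by (rule inj_onD)

lemma Nil_notin_code: assumes "code C" shows "[] \<notin> C"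
proof
  assume "[] \<in> C"
  then have "[[]] = ([] :: 'a list list)"
    using codeD[OF assms, of "[[]]" "[]"] by simp
  then show False by simp
qed

lemma eliminate_subset_star: "x \<in> C \<Longrightarrow> eliminate x C \<subseteq> star C"
  unfolding eliminate_def by (auto intro: append_in_star power_in_star in_star)

lemma append_power_in_eliminate:
  "c \<in> C \<Longrightarrow> c \<noteq> x \<Longrightarrow> c @ concat (replicate i x) \<in> eliminate x C"
  unfolding eliminate_def by blast

lemma ex_power_append_star:
  assumes "w \<in> star C"
  shows "\<exists>j. \<exists>w' \<in> star (eliminate x C). w = concat (replicate j x) @ w'"
proof -
  obtain us where us: "us \<in> lists C" and w: "w = concat us"
    using assms unfolding star_def by blast
  from us have "\<exists>j. \<exists>w' \<in> star (eliminate x C). concat us = concat (replicate j x) @ w'"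
  proof (induction us)
    case Nil
    have "concat [] = concat (replicate 0 x) @ []" by simp
    then show ?case using Nil_in_star by blast
  next
    case (Cons u us)
    then obtain j w' where w': "w' \<in> star (eliminate x C)"
      and us: "concat us = concat (replicate j x) @ w'" by auto
    show ?case
    proof (cases "u = x")
      case True
      then have "concat (u # us) = concat (replicate (Suc j) x) @ w'" by (simp add: us)
      then show ?thesis using w' by blast
    next
      case False
      \<comment> \<open>the leading power of \<open>x\<close> is absorbed by the codeword \<open>u\<close> now in front of it\<close>
      then have "u @ concat (replicate j x) \<in> eliminate x C"
        using Cons.hyps by (intro append_power_in_eliminate) auto
      then have "(u @ concat (replicate j x)) @ w' \<in> star (eliminate x C)"
        by (intro append_in_star in_star w')
      moreover have "concat (u # us) = concat (replicate 0 x) @ (u @ concat (replicate j x)) @ w'"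
        by (simp add: us)
      ultimately show ?thesis by blast
    qed
  qed
  then show ?thesis by (simp add: w)
qed

text \<open>A product of words \<open>c x\<^sup>i\<close> begins with some \<open>c \<noteq> x\<close> when it is spelled in \<open>C\<close>: this is
  why a power of \<open>x\<close> in front of it can be recovered.\<close>

lemma star_eliminate_spelling:
  assumes "w \<in> star (eliminate x C)" "x \<in> C"
  obtains us where "us \<in> lists C" "w = concat us" "us = [] \<or> hd us \<noteq> x"
proof -
  obtain ps where ps: "ps \<in> lists (eliminate x C)" and w: "w = concat ps"
    using assms unfolding star_def by blast
  from ps have "\<exists>us \<in> lists C. concat ps = concat us \<and> (us = [] \<or> hd us \<noteq> x)"
  proof (induction ps)
    case Nil
    show ?case by (rule bexI[of _ "[]"]) simp_all
  next
    case (Cons p ps)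
    then obtain us where us: "us \<in> lists C" "concat ps = concat us" by auto
    obtain c i where c: "c \<in> C" "c \<noteq> x" and p: "p = c @ concat (replicate i x)"
      using Cons.hyps unfolding eliminate_def by auto
    show ?case
      using us c assms(2) by (intro bexI[of _ "c # replicate i x @ us"]) (auto simp: p)
  qed
  then show thesis using that w by blast
qed

lemma power_append_star_unique:
  assumes "code C" "x \<in> C" "w \<in> star (eliminate x C)" "w' \<in> star (eliminate x C)"
    and eq: "concat (replicate i x) @ w = concat (replicate j x) @ w'"
  shows "i = j \<and> w = w'"
proof -
  obtain us where us: "us \<in> lists C" "w = concat us" "us = [] \<or> hd us \<noteq> x"
    by (rule star_eliminate_spelling[OF assms(3,2)])
  obtain vs where vs: "vs \<in> lists C" "w' = concat vs" "vs = [] \<or> hd vs \<noteq> x"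
    by (rule star_eliminate_spelling[OF assms(4,2)])
  have leading_run: "i = j \<and> us = vs"
    if "replicate i x @ us = replicate j x @ vs" for i j
    using that us(3) vs(3)
  proof (induction i arbitrary: j)
    case 0
    then show ?case by (cases j) auto
  next
    case (Suc i)
    then show ?case by (cases j) auto
  qed
  have "replicate i x @ us = replicate j x @ vs"
  proof (rule codeD[OF assms(1)])
    show "concat (replicate i x @ us) = concat (replicate j x @ vs)"
      using eq by (simp add: us vs)
  qed (use us(1) vs(1) assms(2) in auto)
  then show ?thesis using leading_run us vs by blast
qed

lemma trailing_run_unique:
  assumes "us @ c # replicate i x = vs @ d # replicate j x" "c \<noteq> x" "d \<noteq> x"
  shows "us = vs \<and> c = d \<and> i = j"
  using assms(1)
proof (induction i arbitrary: j)
  case 0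
  then show ?case
    using assms(2) by (cases j) (auto simp: replicate_append_same[symmetric])
next
  case (Suc i)
  then show ?case
    using assms(3) by (cases j) (auto simp: replicate_append_same[symmetric])
qed

text \<open>The factors \<open>c x\<^sup>i\<close> of a product are recovered from right to left: in its unique spelling
  in \<open>C\<close>, the last letter other than \<open>x\<close> begins the last factor.\<close>

lemma code_eliminate:
  assumes "code C" "x \<in> C" shows "code (eliminate x C)"
  unfolding code_def
proof (rule inj_onI)
  fix ps qs
  assume "ps \<in> lists (eliminate x C)" "qs \<in> lists (eliminate x C)" "concat ps = concat qs"
  then show "ps = qs"
  proof (induction ps arbitrary: qs rule: rev_induct)
    case Nil
    have "[] \<notin> eliminate x C"
      using Nil_notin_code[OF assms(1)] unfolding eliminate_def by auto
    then show ?case using Nil.prems by (cases qs) auto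
  next
    case (snoc p ps)
    have spelling: "\<exists>us \<in> lists C. concat rs = concat us" if "rs \<in> lists (eliminate x C)" for rs
      using star_subset_star[OF eliminate_subset_star[OF assms(2)]] that
      unfolding star_def by blast
    obtain c i where c: "c \<in> C" "c \<noteq> x" and p: "p = c @ concat (replicate i x)"
      using snoc.prems unfolding eliminate_def by auto
    show ?case
    proof (cases qs rule: rev_cases)
      case Nil
      then show ?thesis using snoc.prems c p Nil_notin_code[OF assms(1)] by auto
    next
      case (snoc qs' q)
      obtain d j where d: "d \<in> C" "d \<noteq> x" and q: "q = d @ concat (replicate j x)"
        using snoc snoc.prems unfolding eliminate_def by auto
      obtain us where us: "us \<in> lists C" "concat ps = concat us"
        using spelling[of ps] snoc.prems by auto
      obtain vs where vs: "vs \<in> lists C" "concat qs' = concat vs"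
        using spelling[of qs'] snoc snoc.prems by auto
      have "us @ c # replicate i x = vs @ d # replicate j x"
      proof (rule codeD[OF assms(1)])
        show "concat (us @ c # replicate i x) = concat (vs @ d # replicate j x)"
          using snoc.prems(3) us(2) vs(2) by (simp add: snoc p q)
      qed (use us(1) vs(1) c d assms(2) in auto)
      then have "us = vs \<and> c = d \<and> i = j" by (rule trailing_run_unique) fact+
      moreover from this have "ps = qs'"
        using snoc snoc.prems us vs by (intro snoc.IH) auto
      ultimately show ?thesis by (simp add: snoc p q)
    qed
  qed
qed

section \<open>Eliminating shortest codewords\<close>

definition shortest :: "'a list set \<Rightarrow> 'a list" where
  "shortest C = (ARG_MIN length c. c \<in> C)"

primrec stage :: "'a set \<Rightarrow> nat \<Rightarrow> 'a list set" where
  "stage A 0 = (\<lambda>a. [a]) ` A"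
| "stage A (Suc k) = eliminate (shortest (stage A k)) (stage A k)"

abbreviation basis_word :: "'a set \<Rightarrow> nat \<Rightarrow> 'a list" where
  "basis_word A k \<equiv> shortest (stage A k)"

lemma shortest_in: "C \<noteq> {} \<Longrightarrow> shortest C \<in> C"
  unfolding shortest_def by (metis arg_min_natI all_not_in_conv)

lemma length_shortest_le: "c \<in> C \<Longrightarrow> length (shortest C) \<le> length c"
  unfolding shortest_def by (rule arg_min_nat_le)

lemma code_singletons: "code ((\<lambda>a. [a]) ` A)"
  unfolding code_def
proof (rule inj_on_inverseI)
  fix us assume "us \<in> lists ((\<lambda>a. [a]) ` A)"
  then show "map (\<lambda>a. [a]) (concat us) = us" by (induction us) auto
qed

lemma star_singletons: "star ((\<lambda>a. [a]) ` A) = lists A"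
proof
  show "star ((\<lambda>a. [a]) ` A) \<subseteq> lists A" unfolding star_def by fastforce
  show "lists A \<subseteq> star ((\<lambda>a. [a]) ` A)"
  proof
    fix w assume "w \<in> lists A"
    then have "map (\<lambda>a. [a]) w \<in> lists ((\<lambda>a. [a]) ` A)" by auto
    moreover have "w = concat (map (\<lambda>a. [a]) w)" by simp
    ultimately show "w \<in> star ((\<lambda>a. [a]) ` A)" unfolding star_def by blast
  qed
qed

text \<open>To carry the elimination on forever, a codeword must be left besides the eliminated one.
  If \<open>c \<noteq> x\<close> is such a word, the next code contains both \<open>c\<close> and \<open>c x\<close>.\<close>

lemma stage_invariant:
  assumes "2 \<le> card A"
  shows "code (stage A k) \<and> (\<exists>c \<in> stage A k. \<exists>d \<in> stage A k. c \<noteq> d)"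
proof (induction k)
  case 0
  obtain B where "B \<subseteq> A" "card B = 2" by (rule obtain_subset_with_card_n[OF assms])
  then obtain a b where "a \<in> A" "b \<in> A" "a \<noteq> b" by (auto simp: card_2_iff)
  then show ?case by (auto simp: code_singletons)
next
  case (Suc k)
  let ?x = "basis_word A k"
  have x: "?x \<in> stage A k" using Suc.IH by (intro shortest_in) auto
  have "?x \<noteq> []" using Nil_notin_code x Suc.IH by metis
  obtain c where "c \<in> stage A k" "c \<noteq> ?x" using Suc.IH by metis
  then have "c @ concat (replicate i ?x) \<in> stage A (Suc k)" for i
    by (simp add: append_power_in_eliminate)
  from this[of 0] this[of 1] have "c \<in> stage A (Suc k)" "c @ ?x \<in> stage A (Suc k)" by simp_all
  moreover have "c \<noteq> c @ ?x" using \<open>?x \<noteq> []\<close> by simp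
  moreover have "code (stage A (Suc k))" using code_eliminate x Suc.IH by auto
  ultimately show ?case by blast
qed

lemma code_stage: "2 \<le> card A \<Longrightarrow> code (stage A k)"
  using stage_invariant by blast

lemma basis_word_in_stage: "2 \<le> card A \<Longrightarrow> basis_word A k \<in> stage A k"
  using stage_invariant by (intro shortest_in) blast

lemma basis_word_not_Nil: "2 \<le> card A \<Longrightarrow> basis_word A k \<noteq> []"
  using Nil_notin_code[OF code_stage] basis_word_in_stage by metis

lemma star_stage_antimono:
  assumes "2 \<le> card A" "k \<le> m" shows "star (stage A m) \<subseteq> star (stage A k)"
  using assms(2)
proof (induction m rule: dec_induct)
  case (step m)
  have "star (stage A (Suc m)) \<subseteq> star (stage A m)"
    by (simp add: star_subset_star eliminate_subset_star basis_word_in_stage assms(1))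
  then show ?case using step.IH by blast
qed simp

lemma star_stage_subset_lists: "2 \<le> card A \<Longrightarrow> star (stage A k) \<subseteq> lists A"
  using star_stage_antimono[of A 0 k] by (simp add: star_singletons)

text \<open>Once every codeword has length at least \<open>L\<close>, the proper new words \<open>c x\<^sup>i\<close>, \<open>i > 0\<close>, are
  longer than \<open>L\<close>. As long as words of length \<open>L\<close> remain, one of them is therefore eliminated
  without replacement. Removing all words up to a given length in one count would not work, since
  a short word may be replaced by several words below that bound.\<close>

lemma stage_longer_step:
  assumes A: "2 \<le> card A" and "\<And>c. c \<in> stage A k \<Longrightarrow> L \<le> length c"
  shows "\<exists>m. \<forall>c \<in> stage A m. L < length c"
  using assms(2)
proof (induction "card {c \<in> stage A k. length c = L}" arbitrary: k rule: less_induct)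
  case less
  let ?x = "basis_word A k"
  let ?S = "\<lambda>k. {c \<in> stage A k. length c = L}"
  note x = basis_word_in_stage[OF A, of k]
  have "finite A" using A by (metis card.infinite not_numeral_le_zero)
  have "stage A k \<subseteq> lists A"
    using star_stage_subset_lists[OF A] by (meson in_star subset_iff)
  then have "?S k \<subseteq> {w. set w \<subseteq> A \<and> length w = L}" by (auto simp: in_lists_conv_set)
  then have fin: "finite (?S k)"
    using finite_lists_length_eq[OF \<open>finite A\<close>] by (rule finite_subset)
  show ?case
  proof (cases "length ?x = L")
    case False
    then have "L < length ?x" using less.prems[OF x] by simp
    then show ?thesis using length_shortest_le[of _ "stage A k"] by (meson less_le_trans)
  next
    case True
    have long: "L \<le> length c" if "c \<in> stage A (Suc k)" for c
      using that less.prems by (auto simp: eliminate_def intro!: trans_le_add1)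
    have "?S (Suc k) \<subseteq> ?S k - {?x}"
    proof
      fix w assume w: "w \<in> ?S (Suc k)"
      then obtain c i where c: "c \<in> stage A k" "c \<noteq> ?x"
        and wc: "w = c @ concat (replicate i ?x)" by (auto simp: eliminate_def)
      have "concat (replicate i ?x) = []" using w wc less.prems[OF c(1)] by auto
      then have "w = c" by (simp only: wc append_Nil2)
      then show "w \<in> ?S k - {?x}" using w c by simp
    qed
    also have "\<dots> \<subset> ?S k" using x True by blast
    finally have "card (?S (Suc k)) < card (?S k)" by (rule psubset_card_mono[OF fin])
    then show ?thesis using less.hyps long by blast
  qed
qed

lemma stage_eventually_longer:
  assumes A: "2 \<le> card A"
  shows "\<exists>m. \<forall>c \<in> stage A m. L < length c"
proof (induction L)
  case 0
  show ?case by (rule stage_longer_step[OF A]) (rule le0)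
next
  case (Suc L)
  then obtain m where "\<forall>c \<in> stage A m. L < length c" by blast
  then show ?case by (intro stage_longer_step[OF A, of m]) (simp add: Suc_le_eq)
qed

section \<open>Ordered factorizations\<close>

text \<open>The factors with index at least \<open>k\<close> are those that are split off from the \<open>k\<close>-th code
  onwards.\<close>

definition ordered_exponents :: "nat \<Rightarrow> (nat \<times> nat) list \<Rightarrow> bool" where
  "ordered_exponents k ps \<longleftrightarrow> sorted_wrt (<) (map fst ps) \<and> (\<forall>(i, \<alpha>) \<in> set ps. k \<le> i \<and> 0 < \<alpha>)"

definition word_product :: "(nat \<Rightarrow> 'a list) \<Rightarrow> (nat \<times> nat) list \<Rightarrow> 'a list" where
  "word_product X ps = concat (map (\<lambda>(i, \<alpha>). concat (replicate \<alpha> (X i))) ps)"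

lemma word_product_simps [simp]:
  "word_product X [] = []"
  "word_product X ((i, \<alpha>) # ps) = concat (replicate \<alpha> (X i)) @ word_product X ps"
  by (simp_all add: word_product_def)

lemma word_product_in_star:
  assumes A: "2 \<le> card A" and "ordered_exponents k ps"
  shows "word_product (basis_word A) ps \<in> star (stage A k)"
  using assms(2)
proof (induction ps)
  case Nil
  show ?case by (simp add: Nil_in_star)
next
  case (Cons p ps)
  obtain i \<alpha> where p: "p = (i, \<alpha>)" by fastforce
  have "k \<le> i" "ordered_exponents k ps" using Cons.prems by (auto simp: ordered_exponents_def p)
  then have "basis_word A i \<in> star (stage A k)"
    using star_stage_antimono[OF A] in_star[OF basis_word_in_stage[OF A]] by blast
  then show ?case
    using Cons.IH \<open>ordered_exponents k ps\<close> by (simp add: p append_in_star power_in_star)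
qed

lemma ordered_exponents_peel:
  assumes "ordered_exponents k ps"
  obtains j ps' where "ordered_exponents (Suc k) ps'" "set ps' \<subseteq> set ps"
    "ps = (if j = 0 then ps' else (k, j) # ps')"
    "word_product X ps = concat (replicate j (X k)) @ word_product X ps'"
proof (cases "\<exists>j ps'. ps = (k, j) # ps'")
  case True
  then obtain j ps' where ps: "ps = (k, j) # ps'" by blast
  have "ordered_exponents (Suc k) ps'"
    using assms by (auto simp: ps ordered_exponents_def Suc_le_eq)
  moreover have "j \<noteq> 0" using assms by (simp add: ps ordered_exponents_def)
  ultimately show thesis by (intro that[of ps' j]) (auto simp: ps)
next
  case False
  have "ordered_exponents (Suc k) ps"
  proof (cases ps)
    case (Cons p qs)
    obtain i \<alpha> where p: "p = (i, \<alpha>)" by fastforce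
    have "k < i" using False assms by (auto simp: Cons p ordered_exponents_def le_less)
    then show ?thesis using assms by (fastforce simp: Cons p ordered_exponents_def)
  qed (simp add: ordered_exponents_def)
  then show thesis by (intro that[of ps 0]) simp_all
qed

lemma ex_word_product:
  assumes "w \<in> star (stage A k)" "\<And>c. c \<in> stage A (k + m) \<Longrightarrow> length w < length c"
  shows "\<exists>ps. ordered_exponents k ps \<and> w = word_product (basis_word A) ps"
  using assms
proof (induction m arbitrary: k w)
  case 0
  \<comment> \<open>a first codeword of \<open>w\<close> would be longer than \<open>w\<close>\<close>
  have "w = []"
  proof -
    obtain us where "us \<in> lists (stage A k)" "w = concat us"
      using 0 unfolding star_def by blast
    then show ?thesis using 0(2) by (cases us) auto
  qed
  then show ?case by (intro exI[of _ "[]"]) (simp add: ordered_exponents_def)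
next
  case (Suc m)
  obtain j w' where w': "w' \<in> star (stage A (Suc k))"
    and w: "w = concat (replicate j (basis_word A k)) @ w'"
    using ex_power_append_star[OF Suc.prems(1), of "basis_word A k"] by auto
  have "length w' < length c" if "c \<in> stage A (Suc k + m)" for c
    using Suc.prems(2)[of c] that by (simp add: w)
  from Suc.IH[OF w' this] obtain ps where
    ps: "ordered_exponents (Suc k) ps" "w' = word_product (basis_word A) ps" by blast
  show ?case
  proof (cases "j = 0")
    case True
    have "ordered_exponents k ps" using ps(1) by (fastforce simp: ordered_exponents_def)
    then show ?thesis using True by (auto simp: w ps)
  next
    case False
    then have "ordered_exponents k ((k, j) # ps)"
      using ps(1) by (fastforce simp: ordered_exponents_def)
    then show ?thesis by (intro exI[of _ "(k, j) # ps"]) (simp add: w ps)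
  qed
qed

lemma word_product_unique_below:
  assumes A: "2 \<le> card A"
    and "ordered_exponents k ps" "ordered_exponents k qs"
    and "\<forall>p \<in> set ps \<union> set qs. fst p < k + m"
    and "word_product (basis_word A) ps = word_product (basis_word A) qs"
  shows "ps = qs"
  using assms(2-)
proof (induction m arbitrary: k ps qs)
  case 0
  then have "ps = []" "qs = []" by (cases ps; cases qs; fastforce simp: ordered_exponents_def)+
  then show ?case by simp
next
  case (Suc m)
  obtain i ps' where ps: "ordered_exponents (Suc k) ps'" "set ps' \<subseteq> set ps"
    "ps = (if i = 0 then ps' else (k, i) # ps')"
    "word_product (basis_word A) ps =
       concat (replicate i (basis_word A k)) @ word_product (basis_word A) ps'"
    by (rule ordered_exponents_peel[OF Suc.prems(1)])
  obtain j qs' where qs: "ordered_exponents (Suc k) qs'" "set qs' \<subseteq> set qs"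
    "qs = (if j = 0 then qs' else (k, j) # qs')"
    "word_product (basis_word A) qs =
       concat (replicate j (basis_word A k)) @ word_product (basis_word A) qs'"
    by (rule ordered_exponents_peel[OF Suc.prems(2)])
  have eq: "i = j \<and> word_product (basis_word A) ps' = word_product (basis_word A) qs'"
  proof (rule power_append_star_unique[of "stage A k" "basis_word A k"])
    show "word_product (basis_word A) ps' \<in> star (eliminate (basis_word A k) (stage A k))"
      using word_product_in_star[OF A ps(1)] by simp
    show "word_product (basis_word A) qs' \<in> star (eliminate (basis_word A k) (stage A k))"
      using word_product_in_star[OF A qs(1)] by simp
  qed (use Suc.prems ps qs code_stage[OF A] basis_word_in_stage[OF A] in auto)
  have "ps' = qs'"
  proof (rule Suc.IH[OF ps(1) qs(1)])
    show "\<forall>p \<in> set ps' \<union> set qs'. fst p < Suc k + m"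
      using Suc.prems(3) ps(2) qs(2) by auto
  qed (use eq in simp)
  then show ?case using eq ps(3) qs(3) by simp
qed

lemma word_product_unique:
  assumes "2 \<le> card A" "ordered_exponents 0 ps" "ordered_exponents 0 qs"
    and "word_product (basis_word A) ps = word_product (basis_word A) qs"
  shows "ps = qs"
proof -
  have "finite (fst ` (set ps \<union> set qs))" by simp
  then obtain m where "\<forall>i \<in> fst ` (set ps \<union> set qs). i < m"
    using finite_nat_set_iff_bounded by blast
  then show ?thesis using assms by (intro word_product_unique_below[of A 0 ps qs m]) auto
qed

lemma word_product_eq_Nil_iff:
  assumes "\<And>i. X i \<noteq> []"
  shows "word_product X ps = [] \<longleftrightarrow> (\<forall>(i, \<alpha>) \<in> set ps. \<alpha> = 0)"
  using assms by (auto simp: word_product_def)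

section \<open>The free semigroup\<close>

lemma monoid_free_semigroup: "monoid (free_semigroup A)"
  by (rule monoidI) (auto simp: free_semigroup_def)

lemma pow_free_semigroup: "x [^]\<^bsub>free_semigroup A\<^esub> (n::nat) = concat (replicate n x)"
proof (induction n)
  case (Suc n)
  have "x [^]\<^bsub>free_semigroup A\<^esub> Suc n = concat (replicate n x @ [x])"
    using Suc by (simp add: nat_pow_def free_semigroup_def)
  then show ?case by (simp only: replicate_append_same replicate_Suc)
qed (simp add: nat_pow_def free_semigroup_def)

lemma power_product_free_semigroup: "power_product (free_semigroup A) X ps = word_product X ps"
proof (induction ps)
  case (Cons p ps)
  then show ?case
    by (cases p) (simp add: power_product_def pow_free_semigroup, simp add: free_semigroup_def)
qed (simp add: power_product_def free_semigroup_def)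

lemma factorization_basis_basis_word:
  assumes A: "2 \<le> card A"
  shows "factorization_basis (free_semigroup A) (basis_word A)"
proof -
  let ?X = "basis_word A"
  have sets: "carrier (free_semigroup A) = lists A" "\<one>\<^bsub>free_semigroup A\<^esub> = []"
    by (simp_all add: free_semigroup_def)
  have ordered: "sorted_wrt (<) (map fst ps) \<and> (\<forall>(i, \<alpha>) \<in> set ps. 0 < \<alpha>)
      \<longleftrightarrow> ordered_exponents 0 ps" for ps
    by (simp add: ordered_exponents_def)
  have range: "range ?X \<subseteq> lists A"
    using star_stage_subset_lists[OF A] in_star[OF basis_word_in_stage[OF A]] by blast
  have factor: "\<exists>!ps. ps \<noteq> [] \<and> sorted_wrt (<) (map fst ps) \<and> (\<forall>(i, \<alpha>) \<in> set ps. 0 < \<alpha>) \<and>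
      w = word_product ?X ps" if "w \<in> lists A - {[]}" for w
  proof -
    obtain m where "\<forall>c \<in> stage A m. length w < length c"
      using stage_eventually_longer[OF A] by blast
    moreover have "w \<in> star (stage A 0)" using that by (simp add: star_singletons)
    ultimately obtain ps where ps: "ordered_exponents 0 ps" "w = word_product ?X ps"
      using ex_word_product[of w A 0 m] by auto
    show ?thesis
    proof (rule ex1I[of _ ps])
      show "ps \<noteq> [] \<and> sorted_wrt (<) (map fst ps) \<and> (\<forall>(i, \<alpha>) \<in> set ps. 0 < \<alpha>) \<and>
          w = word_product ?X ps"
        using that ps ordered by auto
    next
      fix qs
      assume "qs \<noteq> [] \<and> sorted_wrt (<) (map fst qs) \<and> (\<forall>(i, \<alpha>) \<in> set qs. 0 < \<alpha>) \<and>
          w = word_product ?X qs"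
      then show "qs = ps" using ps ordered by (intro word_product_unique[OF A]) auto
    qed
  qed
  have trivial: "\<forall>i<k. \<beta> i = 0" if "[] = word_product ?X (map (\<lambda>i. (i, \<beta> i)) [0..<k])" for k \<beta>
    using iffD1[OF word_product_eq_Nil_iff[OF basis_word_not_Nil[OF A]] that[symmetric]] by simp
  show ?thesis
    unfolding factorization_basis_def power_product_free_semigroup sets
    by (intro conjI ballI allI impI range factor) (simp_all add: trivial)
qed

theorem proposition3p11:
  fixes n :: nat and a :: "nat \<Rightarrow> 'a"
  assumes "n \<ge> 2" and "inj_on a {1..n}"
  shows "unique_factorization_semigroup (free_semigroup (a ` {1..n}))"
proof -
  have "2 \<le> card (a ` {1..n})" using assms by (simp add: card_image)
  then show ?thesis
    unfolding unique_factorization_semigroup_def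
    using monoid_free_semigroup factorization_basis_basis_word by blast
qed

end
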